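(* Let $X$ be the space $\ell_2-\ell_1$, i.e. $\mathbb{R}^2$ endowed with the norm $$\|x\|=\begin{cases}\|x\|_2 & \text{if } x_1x_2\geq 0,\\ \|x\|_1 & \text{if } x_1x_2\leq 0,\end{cases}$$ where $x=(x_1,x_2)$. Then $DW(X)=2\sqrt{2}$. Moreover, $DW(X)>dw(u,v,t)$ for all $u,v\in S_X$ and $0<t<1$, where $$dw(u,v,t)=\frac{(1+t)\|u-v\|}{\|u-tv\|}.$$
   Context: Here $\|x\|_2=\sqrt{x_1^2+x_2^2}$ and $\|x\|_1=|x_1|+|x_2|$. For a real normed linear space $X$, $S_X=\{x\in X:\|x\|=1\}$ denotes its unit sphere, and the Dunkl--Williams constant of $X$ is $$DW(X)=\sup\left\{\frac{\|x\|+\|y\|}{\|x-y\|}\left\|\frac{x}{\|x\|}-\frac{y}{\|y\|}\right\|:\ x,y\in X\setminus\{0\},\ x\neq y\right\}.$$ *)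

theory Defs
  imports "HOL-Analysis.Analysis"
begin

text \<open>
  The supremum is taken in \<^typ>\<open>real\<close>; the set is bounded above by 4 in every normed space
  (lemma \<open>bdd_above_DW\<close>) and nonempty in every nontrivial one.
\<close>

definition DW :: "'a::real_normed_vector itself \<Rightarrow> real" where
  "DW _ = Sup {(norm x + norm y) / norm (x - y) * norm (x /\<^sub>R norm x - y /\<^sub>R norm y) | x y :: 'a.
                 x \<noteq> 0 \<and> y \<noteq> 0 \<and> x \<noteq> y}"

definition dw :: "'a::real_normed_vector \<Rightarrow> 'a \<Rightarrow> real \<Rightarrow> real" where
  "dw u v t = (1 + t) * norm (u - v) / norm (u - t *\<^sub>R v)"

lemma norm_mult_angle_le:
  fixes x y :: "'a::real_normed_vector"
  assumes "x \<noteq> 0" "y \<noteq> 0"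
  shows "norm x * norm (x /\<^sub>R norm x - y /\<^sub>R norm y) \<le> 2 * norm (x - y)"
proof -
  have "norm x * norm (x /\<^sub>R norm x - y /\<^sub>R norm y)
          = norm (norm x *\<^sub>R (x /\<^sub>R norm x - y /\<^sub>R norm y))"
    by simp
  also have "norm x *\<^sub>R (x /\<^sub>R norm x - y /\<^sub>R norm y) = (x - y) + (norm y - norm x) *\<^sub>R (y /\<^sub>R norm y)"
  proof -
    have "(norm y - norm x) * inverse (norm y) = 1 - norm x * inverse (norm y)"
      using assms by (simp add: left_diff_distrib)
    then show ?thesis
      using assms by (simp add: scaleR_diff_right scaleR_diff_left)
  qed
  also have "norm \<dots> \<le> norm (x - y) + norm ((norm y - norm x) *\<^sub>R (y /\<^sub>R norm y))"
    by (rule norm_triangle_ineq)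
  also have "norm ((norm y - norm x) *\<^sub>R (y /\<^sub>R norm y)) = \<bar>norm y - norm x\<bar>"
    using assms by (simp add: abs_mult)
  also have "\<dots> \<le> norm (x - y)"
    using norm_triangle_ineq3[of y x] by (simp add: norm_minus_commute)
  finally show ?thesis by simp
qed

lemma bdd_above_DW:
  "bdd_above {(norm x + norm y) / norm (x - y) * norm (x /\<^sub>R norm x - y /\<^sub>R norm y)
                | x y :: 'a::real_normed_vector. x \<noteq> 0 \<and> y \<noteq> 0 \<and> x \<noteq> y}"
proof (rule bdd_aboveI[where M = 4], clarify)
  fix x y :: 'a
  assume *: "x \<noteq> 0" "y \<noteq> 0" "x \<noteq> y"
  have "(norm x + norm y) * norm (x /\<^sub>R norm x - y /\<^sub>R norm y) \<le> 4 * norm (x - y)"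
    using norm_mult_angle_le[OF *(1,2)] norm_mult_angle_le[OF *(2,1)]
    by (simp add: norm_minus_commute distrib_right)
  then show "(norm x + norm y) / norm (x - y) * norm (x /\<^sub>R norm x - y /\<^sub>R norm y) \<le> 4"
    using * by (simp add: divide_le_eq)
qed


text \<open>
  A fresh copy of the plane, since the product type and vectors already carry the Euclidean norm.
\<close>

datatype l2l1 = L2L1 (coord1: real) (coord2: real)

lemma l2l1_eq_iff: "x = y \<longleftrightarrow> coord1 x = coord1 y \<and> coord2 x = coord2 y"
  by (cases x; cases y) simp

instantiation l2l1 :: real_vector
begin

definition "0 = L2L1 0 0"
definition "x + y = L2L1 (coord1 x + coord1 y) (coord2 x + coord2 y)"
definition "- x = L2L1 (- coord1 x) (- coord2 x)"
definition "x - y = L2L1 (coord1 x - coord1 y) (coord2 x - coord2 y)"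
definition "a *\<^sub>R x = L2L1 (a * coord1 x) (a * coord2 x)"

instance
  by standard
    (simp_all add: l2l1_eq_iff zero_l2l1_def plus_l2l1_def uminus_l2l1_def minus_l2l1_def
      scaleR_l2l1_def algebra_simps)

end

lemma coord_simps [simp]:
  "coord1 0 = 0" "coord2 0 = 0"
  "coord1 (x + y) = coord1 x + coord1 y" "coord2 (x + y) = coord2 x + coord2 y"
  "coord1 (- x) = - coord1 x" "coord2 (- x) = - coord2 x"
  "coord1 (x - y) = coord1 x - coord1 y" "coord2 (x - y) = coord2 x - coord2 y"
  "coord1 (a *\<^sub>R x) = a * coord1 x" "coord2 (a *\<^sub>R x) = a * coord2 x"
  by (simp_all add: zero_l2l1_def plus_l2l1_def uminus_l2l1_def minus_l2l1_def scaleR_l2l1_def)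

instantiation l2l1 :: real_normed_vector
begin

definition norm_l2l1_def:
  "norm x = (if coord1 x * coord2 x \<ge> 0 then sqrt ((coord1 x)\<^sup>2 + (coord2 x)\<^sup>2)
             else \<bar>coord1 x\<bar> + \<bar>coord2 x\<bar>)"

definition sgn_l2l1_def: "sgn (x::l2l1) = x /\<^sub>R norm x"

definition dist_l2l1_def: "dist (x::l2l1) y = norm (x - y)"

definition uniformity_l2l1_def:
  "(uniformity :: (l2l1 \<times> l2l1) filter) = (INF e\<in>{0 <..}. principal {(x, y). dist x y < e})"

definition open_l2l1_def:
  "open (U :: l2l1 set) \<longleftrightarrow> (\<forall>x\<in>U. eventually (\<lambda>(x', y). x' = x \<longrightarrow> y \<in> U) uniformity)"

instance
proof
  fix a :: real and x y :: l2l1 and U :: "l2l1 set"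
  show "norm x = 0 \<longleftrightarrow> x = 0"
    by (auto simp: norm_l2l1_def l2l1_eq_iff)
  show "norm (a *\<^sub>R x) = \<bar>a\<bar> * norm x"
  proof (cases "a = 0")
    case False
    have "a * coord1 x * (a * coord2 x) = a\<^sup>2 * (coord1 x * coord2 x)"
      by (simp add: power2_eq_square algebra_simps)
    then have "0 \<le> a * coord1 x * (a * coord2 x) \<longleftrightarrow> 0 \<le> coord1 x * coord2 x"
      using False by (simp only: zero_le_mult_iff[of "a\<^sup>2"]) auto
    moreover have "sqrt ((a * coord1 x)\<^sup>2 + (a * coord2 x)\<^sup>2)
                     = \<bar>a\<bar> * sqrt ((coord1 x)\<^sup>2 + (coord2 x)\<^sup>2)"
      by (simp add: power_mult_distrib distrib_left[symmetric] real_sqrt_mult)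
    ultimately show ?thesis
      by (simp add: norm_l2l1_def abs_mult distrib_left)
  qed (simp add: norm_l2l1_def)
  have diff_le: "\<bar>coord1 z - coord2 z\<bar> \<le> norm z" for z :: l2l1
  proof (cases "coord1 z * coord2 z \<ge> 0")
    case True
    then have "\<bar>coord1 z - coord2 z\<bar> \<le> sqrt ((coord1 z)\<^sup>2 + (coord2 z)\<^sup>2)"
      by (intro real_le_rsqrt) (simp add: power2_diff)
    with True show ?thesis by (simp add: norm_l2l1_def)
  qed (auto simp: norm_l2l1_def)
  have pos_le: "sqrt ((max 0 (coord1 z))\<^sup>2 + (max 0 (coord2 z))\<^sup>2) \<le> norm z" for z :: l2l1
  proof (cases "coord1 z * coord2 z \<ge> 0")
    case True
    then show ?thesis by (auto simp: norm_l2l1_def max_def intro!: real_sqrt_le_mono)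
  next
    case False
    then show ?thesis
      by (auto simp: norm_l2l1_def max_def mult_less_0_iff zero_le_mult_iff)
  qed
  have quadrant: "norm (x + y) \<le> norm x + norm y"
    if "coord1 (x + y) \<ge> 0" "coord2 (x + y) \<ge> 0" for x y :: l2l1
  proof -
    have "norm (x + y) = sqrt ((coord1 x + coord1 y)\<^sup>2 + (coord2 x + coord2 y)\<^sup>2)"
      using that by (simp add: norm_l2l1_def)
    also have "\<dots> \<le> sqrt ((max 0 (coord1 x) + max 0 (coord1 y))\<^sup>2 +
                           (max 0 (coord2 x) + max 0 (coord2 y))\<^sup>2)"
      using that by (intro real_sqrt_le_mono add_mono power_mono) auto
    also have "\<dots> \<le> sqrt ((max 0 (coord1 x))\<^sup>2 + (max 0 (coord2 x))\<^sup>2) +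
                     sqrt ((max 0 (coord1 y))\<^sup>2 + (max 0 (coord2 y))\<^sup>2)"
      by (rule real_sqrt_sum_squares_triangle_ineq)
    also have "\<dots> \<le> norm x + norm y"
      by (intro add_mono pos_le)
    finally show ?thesis .
  qed
  have minus: "norm (- z) = norm z" for z :: l2l1
    by (simp add: norm_l2l1_def)
  consider "coord1 (x + y) \<ge> 0" "coord2 (x + y) \<ge> 0"
    | "coord1 (- x + - y) \<ge> 0" "coord2 (- x + - y) \<ge> 0"
    | "coord1 (x + y) * coord2 (x + y) < 0"
    by (fastforce simp: mult_less_0_iff not_le)
  then show "norm (x + y) \<le> norm x + norm y"
  proof cases
    case 1
    then show ?thesis by (rule quadrant)
  next
    case 2
    from quadrant[OF this] have "norm (- (x + y)) \<le> norm (- x) + norm (- y)" by simp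
    then show ?thesis by (simp only: minus)
  next
    case 3
    then have "norm (x + y) = \<bar>coord1 (x + y) - coord2 (x + y)\<bar>"
      by (auto simp: norm_l2l1_def mult_less_0_iff zero_le_mult_iff)
    also have "\<dots> \<le> \<bar>coord1 x - coord2 x\<bar> + \<bar>coord1 y - coord2 y\<bar>"
      by simp
    also have "\<dots> \<le> norm x + norm y"
      by (intro add_mono diff_le)
    finally show ?thesis .
  qed
qed (rule sgn_l2l1_def dist_l2l1_def uniformity_l2l1_def open_l2l1_def)+

end

text \<open>
  The two branches of the norm agree on the coordinate axes, so both closed conditions
  determine it.
\<close>

lemma norm_l2l1_same_sign:
  "coord1 x * coord2 x \<ge> 0 \<Longrightarrow> norm x = sqrt ((coord1 x)\<^sup>2 + (coord2 x)\<^sup>2)"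
  by (simp add: norm_l2l1_def)

lemma norm_l2l1_opposite_sign:
  "coord1 x * coord2 x \<le> 0 \<Longrightarrow> norm x = \<bar>coord1 x\<bar> + \<bar>coord2 x\<bar>"
  by (cases "coord1 x * coord2 x = 0") (auto simp: norm_l2l1_def)

end

theory Submission
  imports Defs
begin

text \<open>
  For unit vectors \<open>u\<close>, \<open>v\<close> and distinct \<open>s, r > 0\<close> one shows
  \<open>(s + r) * norm (u - v) < 2 * sqrt 2 * norm (s u - r v)\<close>. If both vectors lie on
  the Euclidean arcs, this is the Euclidean Dunkl--Williams inequality (constant 2) combined with
  \<open>|z|\<^sub>2 \<le> norm z \<le> sqrt 2 * |z|\<^sub>2\<close>; if both lie on the segments, a single coordinate of
  \<open>s u - r v\<close> is large enough. In the mixed case let \<open>u\<close> be in the first quadrant and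
  \<open>v = (1 - b, -b)\<close>. If \<open>u - v\<close> has coordinates of opposite signs, sliding \<open>v\<close> along the segment
  to \<open>(1, 0)\<close> keeps \<open>norm (u - v)\<close> and does not increase \<open>norm (s u - r v)\<close>, which leads
  back to the Euclidean case; otherwise \<open>norm (u - v)\<close> is Euclidean, and a quadratic form in
  \<open>s, r\<close> is positive definite. The constant is approached by the vectors \<open>(1 - a, -a)\<close> and
  \<open>(1 - a, 0)\<close> as \<open>a \<rightarrow> 0\<close>.
\<close>

section \<open>Comparison of the norm with the Euclidean norm and with coordinates\<close>

lemma coord_sq_le_norm_sq:
  fixes z :: l2l1
  shows "(coord1 z)\<^sup>2 + (coord2 z)\<^sup>2 \<le> (norm z)\<^sup>2"
  by (auto simp: norm_l2l1_def power2_sum)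

lemma norm_sq_le_coord_sq:
  fixes z :: l2l1
  shows "(norm z)\<^sup>2 \<le> 2 * ((coord1 z)\<^sup>2 + (coord2 z)\<^sup>2)"
proof -
  have "0 \<le> (\<bar>coord1 z\<bar> - \<bar>coord2 z\<bar>)\<^sup>2" by simp
  then show ?thesis
    by (auto simp: norm_l2l1_def power2_sum power2_diff)
qed

lemma abs_coord1_le_norm: "\<bar>coord1 z\<bar> \<le> norm (z::l2l1)"
  by (auto simp: norm_l2l1_def)

lemma abs_coord2_le_norm: "\<bar>coord2 z\<bar> \<le> norm (z::l2l1)"
  by (auto simp: norm_l2l1_def)

text \<open>For coordinates of opposite signs this is an equality; otherwise the square of the left
  side is the Euclidean square minus twice a nonnegative product.\<close>

lemma coord_diff_le_norm: "\<bar>coord1 z - coord2 z\<bar> \<le> norm (z::l2l1)"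
proof (cases "coord1 z * coord2 z \<ge> 0")
  case True
  then have "\<bar>coord1 z - coord2 z\<bar> \<le> sqrt ((coord1 z)\<^sup>2 + (coord2 z)\<^sup>2)"
    by (intro real_le_rsqrt) (simp add: power2_diff)
  with True show ?thesis by (simp add: norm_l2l1_def)
qed (auto simp: norm_l2l1_def)

section \<open>The scaled inequality and its symmetries\<close>

text \<open>Reflection in the diagonal: an isometry that preserves the first quadrant and exchanges
  the two segments of the unit sphere.\<close>

definition swap :: "l2l1 \<Rightarrow> l2l1" where
  "swap z = L2L1 (coord2 z) (coord1 z)"

lemma norm_swap [simp]: "norm (swap z) = norm z"
  by (simp add: norm_l2l1_def swap_def mult.commute add.commute)

lemma swap_diff: "swap (x - y) = swap x - swap y"
  and swap_scaleR: "swap (c *\<^sub>R x) = c *\<^sub>R swap x"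
  by (simp_all add: swap_def l2l1_eq_iff)

text \<open>Two scales keep the relation symmetric and serve both uses: \<open>s\<close> and
  \<open>r\<close> are the norms of two vectors for \<open>DW\<close>, and \<open>1\<close> and
  \<open>t\<close> for \<open>dw\<close>. At \<open>s = r\<close> and \<open>u = v\<close> both
  sides vanish, so strictness needs distinct scales.\<close>

definition dw_bound :: "l2l1 \<Rightarrow> l2l1 \<Rightarrow> bool" where
  "dw_bound u v \<longleftrightarrow> (\<forall>s>0. \<forall>r>0. s \<noteq> r \<longrightarrow>
     (s + r) * norm (u - v) < 2 * sqrt 2 * norm (s *\<^sub>R u - r *\<^sub>R v))"

lemma dw_bound_commute: "dw_bound u v \<Longrightarrow> dw_bound v u"
  unfolding dw_bound_def by (metis add.commute norm_minus_commute)

lemma dw_bound_uminus: "dw_bound (- u) (- v) \<longleftrightarrow> dw_bound u v"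
proof -
  have "norm (- u - - v) = norm (u - v)"
    "norm (s *\<^sub>R (- u) - r *\<^sub>R (- v)) = norm (s *\<^sub>R u - r *\<^sub>R v)" for s r
    using norm_minus_cancel[of "u - v"] norm_minus_cancel[of "s *\<^sub>R u - r *\<^sub>R v"]
    by (simp_all add: norm_minus_commute)
  then show ?thesis unfolding dw_bound_def by simp
qed

lemma dw_bound_swap: "dw_bound (swap u) (swap v) \<longleftrightarrow> dw_bound u v"
  unfolding dw_bound_def by (simp flip: swap_diff swap_scaleR)

lemma dw_bound_refl:
  assumes "norm u = 1"
  shows "dw_bound u u"
proof -
  have "norm (s *\<^sub>R u - r *\<^sub>R u) = \<bar>s - r\<bar>" for s r
    using assms by (simp flip: scaleR_left_diff_distrib)
  then show ?thesis by (simp add: dw_bound_def)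
qed

section \<open>Both vectors on the Euclidean circle\<close>

lemma less_sqrt2_multI:
  fixes A N :: real
  assumes "A\<^sup>2 < 8 * N\<^sup>2" "0 \<le> N"
  shows "A < 2 * sqrt 2 * N"
proof (rule power2_less_imp_less)
  show "A\<^sup>2 < (2 * sqrt 2 * N)\<^sup>2"
    using assms by (simp add: power_mult_distrib)
qed (use assms in simp)

lemma mult_less_sqrt2_mult:
  fixes x :: real
  assumes "0 < x"
  shows "x * 2 < 2 * sqrt 2 * x"
  using assms by (intro less_sqrt2_multI) (simp_all add: power_mult_distrib)

lemma dw_bound_euclidean:
  assumes u: "(coord1 u)\<^sup>2 + (coord2 u)\<^sup>2 = 1" and v: "(coord1 v)\<^sup>2 + (coord2 v)\<^sup>2 = 1"
    and nv: "norm v = 1"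
  shows "dw_bound u v"
  unfolding dw_bound_def
proof (intro allI impI)
  fix s r :: real
  assume s: "0 < s" and r: "0 < r" and sr: "s \<noteq> r"
  define c where "c = coord1 u * coord1 v + coord2 u * coord2 v"
  have sum: "(coord1 u + coord1 v)\<^sup>2 + (coord2 u + coord2 v)\<^sup>2 = 2 + 2 * c"
    using u v by (simp add: c_def power2_sum algebra_simps)
  show "(s + r) * norm (u - v) < 2 * sqrt 2 * norm (s *\<^sub>R u - r *\<^sub>R v)"
  \<comment> \<open>The gap used below is a multiple of \<open>1 + c\<close>, which vanishes for
    antipodal vectors; there both norms are computed exactly.\<close>
  proof (cases "c = -1")
    case True
    then have "coord1 u + coord1 v = 0 \<and> coord2 u + coord2 v = 0"
      using sum by (simp flip: sum_power2_eq_zero_iff)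
    then have "u = - v"
      by (simp add: l2l1_eq_iff eq_neg_iff_add_eq_0)
    have "u - v = (-2) *\<^sub>R v" "s *\<^sub>R u - r *\<^sub>R v = (- s - r) *\<^sub>R v"
      unfolding \<open>u = - v\<close> by (simp_all add: l2l1_eq_iff algebra_simps)
    then have "norm (u - v) = 2" "norm (s *\<^sub>R u - r *\<^sub>R v) = s + r"
      using nv s r by simp_all
    then show ?thesis using s r mult_less_sqrt2_mult[of "s + r"] by simp
  next
    case False
    then have c: "c > -1"
      using sum by (smt (verit) zero_le_power2)
    have "(coord1 (u - v))\<^sup>2 + (coord2 (u - v))\<^sup>2 = 2 - 2 * c"
      using u v by (simp add: c_def power2_diff algebra_simps)
    then have "((s + r) * norm (u - v))\<^sup>2 \<le> (s + r)\<^sup>2 * (2 * (2 - 2 * c))"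
      using norm_sq_le_coord_sq[of "u - v"] by (simp add: power_mult_distrib mult_left_mono)
    \<comment> \<open>The subtracted term is the slack in the Euclidean inequality; it is positive
      because \<open>s\<close> and \<open>r\<close> differ and \<open>c > -1\<close>.\<close>
    also have "\<dots> = 8 * (s\<^sup>2 + r\<^sup>2 - 2 * s * r * c) - 4 * (s - r)\<^sup>2 * (1 + c)"
      by algebra
    also have "\<dots> < 8 * (s\<^sup>2 + r\<^sup>2 - 2 * s * r * c)"
      using c sr by simp
    also have "s\<^sup>2 + r\<^sup>2 - 2 * s * r * c
        = (coord1 (s *\<^sub>R u - r *\<^sub>R v))\<^sup>2 + (coord2 (s *\<^sub>R u - r *\<^sub>R v))\<^sup>2"
      unfolding coord_simps c_def using u v by algebra
    also have "8 * \<dots> \<le> 8 * (norm (s *\<^sub>R u - r *\<^sub>R v))\<^sup>2"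
      by (intro mult_left_mono coord_sq_le_norm_sq) simp
    finally show ?thesis
      by (rule less_sqrt2_multI) simp
  qed
qed

section \<open>Both vectors on the segments\<close>

text \<open>The difference \<open>u - v\<close> is \<open>b - a\<close> times the vector (1, 1). The
  larger scale \<open>s\<close> bounds \<open>s + r\<close> strictly by \<open>2 * s\<close>, and
  the sign of \<open>b - a\<close> decides which coordinate of \<open>s u - r v\<close> has absolute
  value at least \<open>s * \<bar>b - a\<bar>\<close>.\<close>

lemma dw_bound_same_segment_aux:
  assumes "u = L2L1 (1 - a) (- a)" "v = L2L1 (1 - b) (- b)"
    and ab: "0 \<le> a" "a \<le> 1" "0 \<le> b" "b \<le> 1" "a \<noteq> b" and sr: "0 < r" "r < s"
  shows "(s + r) * norm (u - v) < 2 * sqrt 2 * norm (s *\<^sub>R u - r *\<^sub>R v)"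
proof -
  have *: "s * \<bar>b - a\<bar> \<le> norm (s *\<^sub>R u - r *\<^sub>R v)"
  proof (cases "a < b")
    case True
    have "s * (b - a) + (s - r) * (1 - b) = coord1 (s *\<^sub>R u - r *\<^sub>R v)"
      using assms by (simp add: algebra_simps)
    moreover have "0 \<le> (s - r) * (1 - b)" using assms by simp
    ultimately show ?thesis
      using abs_coord1_le_norm[of "s *\<^sub>R u - r *\<^sub>R v"] True by simp
  next
    case False
    have "s * (a - b) + (s - r) * b = - coord2 (s *\<^sub>R u - r *\<^sub>R v)"
      using assms by (simp add: algebra_simps)
    moreover have "0 \<le> (s - r) * b" using assms by simp
    ultimately show ?thesis
      using abs_coord2_le_norm[of "s *\<^sub>R u - r *\<^sub>R v"] False by simp
  qed
  have "norm (u - v) = sqrt 2 * \<bar>b - a\<bar>"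
    using assms by (simp add: norm_l2l1_same_sign real_sqrt_mult power2_commute[of a b]
        flip: power2_eq_square mult_2)
  then have "(s + r) * norm (u - v) = sqrt 2 * ((s + r) * \<bar>b - a\<bar>)" by simp
  also have "\<dots> < sqrt 2 * (2 * (s * \<bar>b - a\<bar>))"
    using assms by (simp add: algebra_simps flip: mult_2)
  also have "\<dots> \<le> sqrt 2 * (2 * norm (s *\<^sub>R u - r *\<^sub>R v))"
    using * by simp
  finally show ?thesis by (simp add: mult_ac)
qed

lemma dw_bound_same_segment:
  assumes "u = L2L1 (1 - a) (- a)" "v = L2L1 (1 - b) (- b)"
    and ab: "0 \<le> a" "a \<le> 1" "0 \<le> b" "b \<le> 1"
  shows "dw_bound u v"
proof (cases "a = b")
  case True
  have "norm u = 1"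
    using assms by (simp add: norm_l2l1_opposite_sign mult_nonneg_nonneg)
  with True assms show ?thesis by (simp add: dw_bound_refl)
next
  case False
  show ?thesis
    unfolding dw_bound_def
  proof (intro allI impI)
    fix s r :: real
    assume sr: "0 < s" "0 < r" "s \<noteq> r"
    show "(s + r) * norm (u - v) < 2 * sqrt 2 * norm (s *\<^sub>R u - r *\<^sub>R v)"
    proof (cases "r < s")
      case True
      then show ?thesis using dw_bound_same_segment_aux assms False sr by blast
    next
      case 2: False
      then have "(r + s) * norm (v - u) < 2 * sqrt 2 * norm (r *\<^sub>R v - s *\<^sub>R u)"
        using dw_bound_same_segment_aux[of v b u a s r] assms False sr by simp
      then show ?thesis by (simp add: norm_minus_commute add.commute)
    qed
  qed
qed

text \<open>Both \<open>s u\<close> and \<open>- r v\<close> lie in the closed fourth quadrant,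
  where the norm is additive, so the norm of their sum is \<open>s + r\<close>.\<close>

lemma dw_bound_opposite_segments:
  assumes "u = L2L1 (1 - a) (- a)" "v = L2L1 (- (1 - b)) b"
    and ab: "0 \<le> a" "a \<le> 1" "0 \<le> b" "b \<le> 1"
  shows "dw_bound u v"
  unfolding dw_bound_def
proof (intro allI impI)
  fix s r :: real
  assume sr: "0 < s" "0 < r" "s \<noteq> r"
  have n: "norm (s *\<^sub>R u - r *\<^sub>R v) = s + r" if "0 < s" "0 < r" for s r
  proof -
    have "s *\<^sub>R u - r *\<^sub>R v = L2L1 (s * (1 - a) + r * (1 - b)) (- (s * a + r * b))"
      unfolding assms(1,2) by (simp add: l2l1_eq_iff algebra_simps)
    moreover have "0 \<le> s * (1 - a) + r * (1 - b)" "0 \<le> s * a + r * b"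
      using assms that by simp_all
    then have "norm (L2L1 (s * (1 - a) + r * (1 - b)) (- (s * a + r * b))) =
        (s * (1 - a) + r * (1 - b)) + (s * a + r * b)"
      by (subst norm_l2l1_opposite_sign) (simp_all only: l2l1.sel abs_minus abs_of_nonneg
        mult_minus_right neg_le_0_iff_le mult_nonneg_nonneg abs_minus_cancel)
    ultimately show ?thesis by (simp add: algebra_simps)
  qed
  from n[of 1 1] have "norm (u - v) = 2" by simp
  then show "(s + r) * norm (u - v) < 2 * sqrt 2 * norm (s *\<^sub>R u - r *\<^sub>R v)"
    using n[OF sr(1,2)] sr mult_less_sqrt2_mult[of "s + r"] by simp
qed

section \<open>One vector on an arc, the other on a segment\<close>

text \<open>A nonpositive \<open>C\<close> makes the cross term harmless; otherwise multiplying by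
  \<open>A\<close> and completing the square leaves the discriminant.\<close>

lemma quadratic_form_pos:
  fixes A B C s r :: real
  assumes "0 < A" "0 \<le> B" "0 < s" "0 < r" and d: "C \<le> 0 \<or> C\<^sup>2 < A * B"
  shows "0 < A * s\<^sup>2 + B * r\<^sup>2 - 2 * s * r * C"
proof (cases "C \<le> 0")
  case True
  then have "0 \<le> - (2 * s * r * C)" using assms by (simp add: mult_nonneg_nonpos)
  moreover have "0 < A * s\<^sup>2" "0 \<le> B * r\<^sup>2" using assms by simp_all
  ultimately show ?thesis by linarith
next
  case False
  have "A * (A * s\<^sup>2 + B * r\<^sup>2 - 2 * s * r * C) = (A * s - r * C)\<^sup>2 + r\<^sup>2 * (A * B - C\<^sup>2)"
    by algebra
  also have "\<dots> > 0"
    using False d assms by (intro add_nonneg_pos) auto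
  finally show ?thesis using assms by (simp add: zero_less_mult_iff)
qed

text \<open>For \<open>v = (1 - b, -b)\<close>, \<open>E\<close> is its Euclidean square,
  \<open>c\<close> stands for its inner product with \<open>u\<close>, and \<open>D\<close> for the
  Euclidean square of \<open>u - v\<close>. This is the discriminant condition for the form
  \<open>8 |s u - r v|^2 - (s + r)^2 D\<close> in \<open>s\<close> and \<open>r\<close>, with
  Euclidean lengths.\<close>

lemma mixed_discriminant:
  fixes b c :: real
  assumes b: "0 < b" "b \<le> 1" and c: "c \<le> 1 - b"
  defines "E \<equiv> (1 - b)\<^sup>2 + b\<^sup>2"
  defines "D \<equiv> 1 + E - 2 * c"
  shows "8 * c + D \<le> 0 \<or> (8 * c + D)\<^sup>2 < (8 - D) * (8 * E - D)"
proof (cases "8 * c + D \<le> 0")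
  case False
  have id: "(8 - D) * (8 * E - D) - (8 * c + D)\<^sup>2 = 8 * (8 * E - 4 * c\<^sup>2 - (1 + E)\<^sup>2)"
    unfolding D_def by algebra
  have E: "E = 1 - 2 * (b * (1 - b))" unfolding E_def by algebra
  have "0 \<le> (1 - 2 * b)\<^sup>2" by simp
  then have bm: "b * (1 - b) \<le> 1 / 4" "0 \<le> b * (1 - b)"
    using b by (simp_all add: power2_eq_square algebra_simps)
  have "0 < 8 * E - 4 * c\<^sup>2 - (1 + E)\<^sup>2"
  proof (cases "0 \<le> c")
    case True
    \<comment> \<open>The extreme value \<open>c = 1 - b\<close> is the worst case, and there the
      expression factors.\<close>
    then have "c\<^sup>2 \<le> (1 - b)\<^sup>2" using c by (simp add: power_mono)
    moreover have "8 * E - 4 * (1 - b)\<^sup>2 - (1 + E)\<^sup>2 = 4 * b\<^sup>2 * (1 - (1 - b)\<^sup>2)"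
      unfolding E_def by algebra
    moreover have "(1 - b)\<^sup>2 < 1"
      using b by (simp add: abs_square_less_1)
    ultimately show ?thesis
      using b by (smt (verit) mult_pos_pos zero_less_power)
  next
    case neg: False
    \<comment> \<open>The assumption \<open>8 * c + D > 0\<close> reads
      \<open>6 * c > - (1 + E)\<close>, and \<open>E \<le> 1\<close>.\<close>
    have "- c < 1 / 3" using False E bm unfolding D_def by linarith
    then have "c\<^sup>2 < (1 / 3)\<^sup>2" using neg by (subst power2_minus[symmetric], intro power_strict_mono) auto
    then have "c\<^sup>2 < 1 / 9" by (simp add: power2_eq_square)
    \<comment> \<open>As \<open>E\<close> lies between 1/2 and 1, this replaces the square of
      \<open>E\<close> by a linear upper bound.\<close>
    moreover have "0 \<le> (E - 1 / 2) * (1 - E)" using E bm by simp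
    then have "8 * E - (1 + E)\<^sup>2 \<ge> 1 / 2 + 9 / 2 * E - 1"
      by (simp add: power2_eq_square field_simps)
    ultimately show ?thesis using E bm by linarith
  qed
  then show ?thesis using id by simp
qed simp

lemma dw_bound_mixed:
  assumes u: "(coord1 u)\<^sup>2 + (coord2 u)\<^sup>2 = 1" "0 \<le> coord1 u" "0 \<le> coord2 u"
    and v: "v = L2L1 (1 - b) (- b)" and b: "0 < b" "b \<le> 1"
  shows "dw_bound u v"
  unfolding dw_bound_def
proof (intro allI impI)
  fix s r :: real
  assume sr: "0 < s" "0 < r" "s \<noteq> r"
  obtain p q where pq: "u = L2L1 p q" by (cases u)
  have p: "0 \<le> p" and q: "0 \<le> q" and pq1: "p\<^sup>2 + q\<^sup>2 = 1" using u pq by simp_all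
  show "(s + r) * norm (u - v) < 2 * sqrt 2 * norm (s *\<^sub>R u - r *\<^sub>R v)"
  \<comment> \<open>The second coordinate \<open>q + b\<close> of \<open>u - v\<close> is positive,
    so the sign of \<open>p - (1 - b)\<close> selects the branch of the norm.\<close>
  proof (cases "p \<le> 1 - b")
    case True
    define e :: l2l1 where "e = L2L1 1 0"
    have "norm (u - v) = 1 - p + q" "norm (u - e) = 1 - p + q"
      using True p q b by (simp_all add: pq v e_def norm_l2l1_opposite_sign mult_nonpos_nonneg)
    moreover have "norm (s *\<^sub>R u - r *\<^sub>R e) \<le> norm (s *\<^sub>R u - r *\<^sub>R v)"
    proof (cases "s * p \<le> r")
      case True
      \<comment> \<open>Here the norm is second minus first coordinate, a functional with the same
        value at \<open>e\<close> and \<open>v\<close>, hence at both scaled differences.\<close>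
      have "norm (s *\<^sub>R u - r *\<^sub>R e) = r - s * p + s * q"
        using True sr q by (simp add: pq e_def norm_l2l1_opposite_sign mult_nonpos_nonneg)
      also have "\<dots> = - (coord1 (s *\<^sub>R u - r *\<^sub>R v) - coord2 (s *\<^sub>R u - r *\<^sub>R v))"
        by (simp add: pq v algebra_simps)
      also have "\<dots> \<le> norm (s *\<^sub>R u - r *\<^sub>R v)"
        using coord_diff_le_norm[of "s *\<^sub>R u - r *\<^sub>R v"] by linarith
      finally show ?thesis .
    next
      case False
      \<comment> \<open>Now \<open>s u - r e\<close> has nonnegative coordinates, and replacing
        \<open>e\<close> by \<open>v\<close> adds \<open>r * b\<close> to each of them.\<close>
      then have "0 \<le> s * p - r" "0 \<le> s * q" "0 \<le> r * b" using sr b q by simp_all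
      then have "(s * p - r)\<^sup>2 + (s * q)\<^sup>2 \<le> (s * p - r + r * b)\<^sup>2 + (s * q + r * b)\<^sup>2"
        by (intro add_mono power_mono) auto
      also have "\<dots> \<le> (norm (s *\<^sub>R u - r *\<^sub>R v))\<^sup>2"
        using coord_sq_le_norm_sq[of "s *\<^sub>R u - r *\<^sub>R v"] by (simp add: pq v algebra_simps)
      finally have "sqrt ((s * p - r)\<^sup>2 + (s * q)\<^sup>2) \<le> norm (s *\<^sub>R u - r *\<^sub>R v)"
        by (intro real_le_lsqrt) simp_all
      moreover have "norm (s *\<^sub>R u - r *\<^sub>R e) = sqrt ((s * p - r)\<^sup>2 + (s * q)\<^sup>2)"
        using \<open>0 \<le> s * p - r\<close> \<open>0 \<le> s * q\<close> by (simp add: pq e_def norm_l2l1_same_sign)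
      ultimately show ?thesis by simp
    qed
    moreover have "dw_bound u e"
      using u by (intro dw_bound_euclidean) (simp_all add: e_def norm_l2l1_same_sign)
    ultimately show ?thesis
      using sr unfolding dw_bound_def by (smt (verit) mult_left_mono real_sqrt_ge_0_iff)
  next
    case False
    define c where "c = p * (1 - b) - q * b"
    define E where "E = (1 - b)\<^sup>2 + b\<^sup>2"
    define D where "D = 1 + E - 2 * c"
    have D: "(norm (u - v))\<^sup>2 = D"
    proof -
      have "(norm (u - v))\<^sup>2 = (p - (1 - b))\<^sup>2 + (q + b)\<^sup>2"
        using False q b by (simp add: pq v norm_l2l1_same_sign)
      also have "\<dots> = D" unfolding D_def E_def c_def using pq1 by algebra
      finally show ?thesis .
    qed
    have "p \<le> 1" "q \<le> 1" using p q pq1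
      by (smt (verit) power2_le_imp_le one_power2 zero_le_power2)+
    then have "p * (1 - b) \<le> 1 - b" "q * b \<le> b" "0 \<le> p * (1 - b)" "0 \<le> q * b"
      using p q b by (simp_all add: mult_left_le_one_le)
    then have c: "c \<le> 1 - b" "- b \<le> c" unfolding c_def by linarith+
    have E: "E = 1 - 2 * (b * (1 - b))" unfolding E_def by algebra
    have "0 \<le> (1 - 2 * b)\<^sup>2" by simp
    then have bm: "b * (1 - b) \<le> 1 / 4" "0 \<le> b * (1 - b)"
      using b by (simp_all add: power2_eq_square algebra_simps)
    have "0 < (8 - D) * s\<^sup>2 + (8 * E - D) * r\<^sup>2 - 2 * s * r * (8 * c + D)"
    proof (rule quadratic_form_pos)
      show "8 * c + D \<le> 0 \<or> (8 * c + D)\<^sup>2 < (8 - D) * (8 * E - D)"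
        using mixed_discriminant[OF b c(1)] unfolding D_def E_def .
      \<comment> \<open>From \<open>- b \<le> c\<close> and \<open>1/2 \<le> E \<le> 1\<close> one
        gets \<open>D \<le> 4\<close> and
        \<open>8 * E - D = 7 * E - 1 + 2 * c \<ge> 1/2\<close>.\<close>
      show "0 < 8 - D" "0 \<le> 8 * E - D" using E bm c b unfolding D_def by linarith+
    qed (use sr in auto)
    also have "\<dots> = 8 * (s\<^sup>2 + r\<^sup>2 * E - 2 * s * r * c) - ((s + r) * norm (u - v))\<^sup>2"
      unfolding power_mult_distrib D by algebra
    also have "s\<^sup>2 + r\<^sup>2 * E - 2 * s * r * c = (s * p - r * (1 - b))\<^sup>2 + (s * q + r * b)\<^sup>2"
      unfolding E_def c_def using pq1 by algebra
    also have "\<dots> \<le> (norm (s *\<^sub>R u - r *\<^sub>R v))\<^sup>2"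
      using coord_sq_le_norm_sq[of "s *\<^sub>R u - r *\<^sub>R v"] by (simp add: pq v)
    finally have "((s + r) * norm (u - v))\<^sup>2 < 8 * (norm (s *\<^sub>R u - r *\<^sub>R v))\<^sup>2" by simp
    then show ?thesis by (rule less_sqrt2_multI) simp
  qed
qed

section \<open>Reduction of all pairs of unit vectors to these cases\<close>

text \<open>The sphere consists of two quarter circles and two segments, each pair exchanged by
  negation; the negative pieces are described through \<open>- u\<close> to match
  \<open>dw_bound_uminus\<close>.\<close>

lemma unit_vector_cases:
  fixes u :: l2l1
  assumes "norm u = 1"
  obtains (arc) "(coord1 u)\<^sup>2 + (coord2 u)\<^sup>2 = 1" "0 \<le> coord1 u" "0 \<le> coord2 u"
    | (neg_arc) "(coord1 u)\<^sup>2 + (coord2 u)\<^sup>2 = 1" "0 \<le> coord1 (- u)" "0 \<le> coord2 (- u)"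
    | (segment) b where "u = L2L1 (1 - b) (- b)" "0 < b" "b \<le> 1"
    | (neg_segment) b where "- u = L2L1 (1 - b) (- b)" "0 < b" "b \<le> 1"
proof (cases "0 \<le> coord1 u * coord2 u")
  case True
  then have "(coord1 u)\<^sup>2 + (coord2 u)\<^sup>2 = 1"
    using assms by (simp add: norm_l2l1_def)
  then show ?thesis using True arc neg_arc by (auto simp: zero_le_mult_iff)
next
  case False
  then have n: "\<bar>coord1 u\<bar> + \<bar>coord2 u\<bar> = 1" using assms by (simp add: norm_l2l1_def)
  from False consider "coord1 u > 0" "coord2 u < 0" | "coord1 u < 0" "coord2 u > 0"
    by (fastforce simp: mult_less_0_iff not_le)
  then show ?thesis
  proof cases
    case 1
    then show ?thesis using n segment[of "- coord2 u"] by (simp add: l2l1_eq_iff)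
  next
    case 2
    then show ?thesis using n neg_segment[of "coord2 u"] by (simp add: l2l1_eq_iff)
  qed
qed

lemma dw_bound_arc_segment:
  assumes u: "(coord1 u)\<^sup>2 + (coord2 u)\<^sup>2 = 1" "0 \<le> coord1 u * coord2 u"
    and v: "norm v = 1" "coord1 v * coord2 v < 0"
  shows "dw_bound u v"
proof -
  have first_quadrant: "dw_bound w z"
    if w: "(coord1 w)\<^sup>2 + (coord2 w)\<^sup>2 = 1" "0 \<le> coord1 w" "0 \<le> coord2 w"
      and z: "norm z = 1" "coord1 z * coord2 z < 0" for w z
    using z(1)
  proof (cases rule: unit_vector_cases)
    case (segment b)
    then show ?thesis using w by (intro dw_bound_mixed) auto
  next
    case (neg_segment b)
    have "dw_bound (swap w) (swap z)"
    \<comment> \<open>Swapping turns \<open>z = (b - 1, b)\<close> into the fourth-quadrant point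
      with parameter \<open>1 - b\<close>. At \<open>b = 1\<close> this parameter would be 0, but
      then \<open>z\<close> lies on an axis, against its strict sign condition.\<close>
    proof (cases "b = 1")
      case True
      then show ?thesis using neg_segment z by (simp add: l2l1_eq_iff)
    next
      case False
      then show ?thesis
        using neg_segment w
        by (intro dw_bound_mixed[where b = "1 - b"])
          (auto simp: swap_def l2l1_eq_iff add.commute)
    qed
    then show ?thesis by (simp add: dw_bound_swap)
  qed (use z in \<open>auto simp: mult_less_0_iff\<close>)
  show ?thesis
  proof (cases "0 \<le> coord1 u \<and> 0 \<le> coord2 u")
    case True
    then show ?thesis using first_quadrant u v by blast
  next
    case False
    then have "0 \<le> coord1 (- u)" "0 \<le> coord2 (- u)" using u by (auto simp: zero_le_mult_iff)
    then have "dw_bound (- u) (- v)" using first_quadrant[of "- u" "- v"] u v by simp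
    then show ?thesis by (simp add: dw_bound_uminus)
  qed
qed

lemma dw_bound_segments:
  assumes u: "norm u = 1" "coord1 u * coord2 u < 0"
    and v: "norm v = 1" "coord1 v * coord2 v < 0"
  shows "dw_bound u v"
proof -
  have fourth_quadrant: "dw_bound w z"
    if w: "w = L2L1 (1 - a) (- a)" "0 \<le> a" "a \<le> 1"
      and z: "norm z = 1" "coord1 z * coord2 z < 0" for w z a
    using z(1)
  proof (cases rule: unit_vector_cases)
    case (segment b)
    then show ?thesis using w by (intro dw_bound_same_segment[where a = a and b = b]) auto
  next
    case (neg_segment b)
    then show ?thesis using w
      by (intro dw_bound_opposite_segments[where a = a and b = b]) (auto simp: l2l1_eq_iff)
  qed (use z in \<open>auto simp: mult_less_0_iff\<close>)
  show ?thesis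
    using u(1)
  proof (cases rule: unit_vector_cases)
    case (segment b)
    then show ?thesis using v fourth_quadrant[of u b] by simp
  next
    case (neg_segment b)
    then have "dw_bound (- u) (- v)" using v fourth_quadrant[of "- u" b "- v"] by simp
    then show ?thesis by (simp add: dw_bound_uminus)
  qed (use u in \<open>auto simp: mult_less_0_iff\<close>)
qed

lemma dw_bound_unit:
  assumes "norm u = 1" "norm v = 1"
  shows "dw_bound u v"
proof -
  have arc: "(coord1 w)\<^sup>2 + (coord2 w)\<^sup>2 = 1"
    if "norm w = 1" "0 \<le> coord1 w * coord2 w" for w :: l2l1
    using that by (simp add: norm_l2l1_def)
  show ?thesis
  proof (cases "0 \<le> coord1 u * coord2 u"; cases "0 \<le> coord1 v * coord2 v")
    assume "0 \<le> coord1 u * coord2 u" "0 \<le> coord1 v * coord2 v"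
    then show ?thesis using assms arc dw_bound_euclidean by blast
  next
    assume "0 \<le> coord1 u * coord2 u" "\<not> 0 \<le> coord1 v * coord2 v"
    then show ?thesis using assms arc dw_bound_arc_segment by (simp add: not_le)
  next
    assume "\<not> 0 \<le> coord1 u * coord2 u" "0 \<le> coord1 v * coord2 v"
    then show ?thesis using assms arc dw_bound_arc_segment dw_bound_commute by (simp add: not_le)
  next
    assume "\<not> 0 \<le> coord1 u * coord2 u" "\<not> 0 \<le> coord1 v * coord2 v"
    then show ?thesis using assms dw_bound_segments by (simp add: not_le)
  qed
qed

section \<open>The value of the constant\<close>

lemma dunkl_williams_quotient_le:
  fixes x y :: l2l1
  assumes "x \<noteq> 0" "y \<noteq> 0" "x \<noteq> y"
  shows "(norm x + norm y) / norm (x - y) * norm (x /\<^sub>R norm x - y /\<^sub>R norm y) \<le> 2 * sqrt 2"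
proof -
  let ?u = "x /\<^sub>R norm x" and ?v = "y /\<^sub>R norm y"
  have xy: "norm x *\<^sub>R ?u = x" "norm y *\<^sub>R ?v = y" using assms by simp_all
  have "(norm x + norm y) * norm (?u - ?v) \<le> 2 * sqrt 2 * norm (x - y)"
  \<comment> \<open>For equal norms, normalizing only rescales \<open>x - y\<close>, and the
    quotient is exactly 2.\<close>
  proof (cases "norm x = norm y")
    case True
    have "norm (?u - ?v) = norm (x - y) / norm y"
      unfolding True by (simp add: divide_inverse mult.commute flip: scaleR_right_diff_distrib)
    then have "(norm x + norm y) * norm (?u - ?v) = 2 * norm (x - y)"
      using assms True by simp
    also have "\<dots> \<le> 2 * sqrt 2 * norm (x - y)"
      by (intro mult_right_mono) auto
    finally show ?thesis .
  next
    case False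
    have "dw_bound ?u ?v" using assms by (intro dw_bound_unit) simp_all
    with False assms have "(norm x + norm y) * norm (?u - ?v)
        < 2 * sqrt 2 * norm (norm x *\<^sub>R ?u - norm y *\<^sub>R ?v)"
      unfolding dw_bound_def by (metis zero_less_norm_iff)
    then show ?thesis unfolding xy by simp
  qed
  then show ?thesis using assms by (simp add: divide_le_eq)
qed

text \<open>The two vectors differ by a vertical vector of norm \<open>a\<close>, while their
  normalizations differ by \<open>(-a, -a)\<close>, of norm \<open>a * sqrt 2\<close>. The norms 1
  and \<open>1 - a\<close> supply the factor \<open>2 - a\<close>.\<close>

lemma DW_l2l1_ge:
  assumes "0 < a" "a < 1"
  shows "(2 - a) * sqrt 2 \<le> DW TYPE(l2l1)"
proof -
  define x where "x = L2L1 (1 - a) (- a)"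
  define y where "y = L2L1 (1 - a) 0"
  have nx: "norm x = 1"
    using assms by (simp add: x_def norm_l2l1_opposite_sign)
  have ny: "norm y = 1 - a"
    using assms by (simp add: y_def norm_l2l1_opposite_sign)
  have nxy: "norm (x - y) = a"
    using assms by (simp add: x_def y_def norm_l2l1_opposite_sign)
  have "x /\<^sub>R norm x - y /\<^sub>R norm y = L2L1 (- a) (- a)"
    unfolding nx ny using assms by (simp add: l2l1_eq_iff x_def y_def)
  then have "norm (x /\<^sub>R norm x - y /\<^sub>R norm y) = a * sqrt 2"
    using assms by (simp add: norm_l2l1_same_sign real_sqrt_mult flip: mult_2)
  then have val: "(2 - a) * sqrt 2
      = (norm x + norm y) / norm (x - y) * norm (x /\<^sub>R norm x - y /\<^sub>R norm y)"
    unfolding nx ny nxy using assms by simp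
  have "x \<noteq> 0" "y \<noteq> 0" "x \<noteq> y"
    using assms by (simp_all add: x_def y_def l2l1_eq_iff)
  then show ?thesis
    unfolding DW_def by (intro cSup_upper[OF _ bdd_above_DW]) (use val in blast)
qed

lemma DW_l2l1: "DW TYPE(l2l1) = 2 * sqrt 2"
proof (rule antisym)
  let ?S = "{(norm x + norm y) / norm (x - y) * norm (x /\<^sub>R norm x - y /\<^sub>R norm y) | x y :: l2l1.
    x \<noteq> 0 \<and> y \<noteq> 0 \<and> x \<noteq> y}"
  have "L2L1 1 0 \<noteq> 0" "L2L1 0 1 \<noteq> 0" "L2L1 1 0 \<noteq> L2L1 0 1"
    by (simp_all add: l2l1_eq_iff)
  then have "?S \<noteq> {}" by blast
  then show "DW TYPE(l2l1) \<le> 2 * sqrt 2"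
    unfolding DW_def
    by (rule cSup_least) (use dunkl_williams_quotient_le in blast)
  \<comment> \<open>The lower bounds stay below the target for each \<open>a > 0\<close>, so they
    are passed to the limit.\<close>
  have "((\<lambda>a::real. (2 - a) * sqrt 2) \<longlongrightarrow> (2 - 0) * sqrt 2) (at_right 0)"
    by (intro tendsto_intros)
  moreover have "\<forall>\<^sub>F a in at_right (0::real). (2 - a) * sqrt 2 \<le> DW TYPE(l2l1)"
    using eventually_at_right_real[OF zero_less_one] by eventually_elim (auto intro: DW_l2l1_ge)
  ultimately have "(2 - 0) * sqrt 2 \<le> DW TYPE(l2l1)"
    by (rule tendsto_upperbound) simp
  then show "2 * sqrt 2 \<le> DW TYPE(l2l1)" by simp
qed

theorem mainTheorem3:
  shows "DW TYPE(l2l1) = 2 * sqrt 2 \<and>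
    (\<forall>u \<in> sphere (0::l2l1) 1. \<forall>v \<in> sphere (0::l2l1) 1. \<forall>t::real.
       0 < t \<and> t < 1 \<longrightarrow> DW TYPE(l2l1) > dw u v t)"
proof (intro conjI ballI allI impI)
  show "DW TYPE(l2l1) = 2 * sqrt 2" by (rule DW_l2l1)
  fix u v :: l2l1 and t :: real
  assume "u \<in> sphere 0 1" "v \<in> sphere 0 1" and t: "0 < t \<and> t < 1"
  then have uv: "norm u = 1" "norm v = 1" by simp_all
  have "(1 + t) * norm (u - v) < 2 * sqrt 2 * norm (1 *\<^sub>R u - t *\<^sub>R v)"
    using dw_bound_unit[OF uv] t unfolding dw_bound_def by (metis less_irrefl zero_less_one)
  \<comment> \<open>Equality \<open>u = t v\<close> would force \<open>t = 1\<close> on comparing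
    norms.\<close>
  moreover have "norm (u - t *\<^sub>R v) > 0"
    using uv t by auto
  ultimately show "dw u v t < DW TYPE(l2l1)"
    by (simp add: dw_def DW_l2l1 divide_less_eq)
qed

end
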